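(* Let $G$ be a group with identity $e$ and $|G|=n\ge 2$. Let $S\subseteq G\setminus\{e\}$ and $T=(G\setminus\{e\})\setminus S$, and suppose $S=S^{-1}$ and $T=T^{-1}$. Then there exists a real $\mu$ such that $S$ is a signature set for an $(n,k(\mu))$-equiangular frame if and only if there exists a real $\mu$ (the same $\mu$) such that for all $g\in S$ $$N_{(S,T)}^g=\frac{n-2-\mu}{4}$$ and for all $h\in T$ $$N_{(S,T)}^h=\frac{n-2+\mu}{4}.$$
   Context: For subsets $A,B\subseteq G$ and $g\in G$, $N_{(A,B)}^g=\#\{(g_1,g_2)\in A\times B: g_1g_2=g\}$, and $A^{-1}=\{a^{-1}:a\in A\}$. An $(n,k)$-frame is a Parseval frame $\{f_1,\dots,f_n\}$ for $\mathbb C^k$, i.e. $\sum_{j}|\langle x,f_j\rangle|^2=\|x\|^2$ for all $x\in\mathbb C^k$. It is equiangular if all $f_i\neq 0$ and there is a constant $b$ with $|\langle f_i/\|f_i\|,f_j/\|f_j\|\rangle|=b$ for all $i\ne j$. For $1\le k<n$, put $c_{n,k}=\sqrt{\frac{k(n-k)}{n^2(n-1)}}$. A self-adjoint $n\times n$ matrix $Q$ with $Q_{ii}=0$ and $|Q_{ij}|=1$ for $i\neq j$ is the signature matrix of an $(n,k)$-equiangular frame if there is an equiangular $(n,k)$-frame whose Gram matrix $(\langle f_j,f_i\rangle)_{i,j}$ equals $\frac kn I_n+c_{n,k}Q$. Throughout $1\le k<n$. The dimension $k$ is parametrized by a real number $\mu$ via $k=k(\mu)=\frac n2-\frac{\mu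 n}{2\sqrt{4(n-1)+\mu^2}}$, equivalently $\mu=(n-2k)\sqrt{\frac{n-1}{k(n-k)}}$; the phrase "$(n,k(\mu))$-equiangular frame" includes that $k(\mu)$ is an integer. Let $\lambda$ be the left regular representation of $G$: $\lambda(g)e_h=e_{gh}$ on the vector space with basis $\{e_h\}_{h\in G}$, regarded as $n\times n$ permutation matrices. For $S\subseteq G\setminus\{e\}$ and $T=(G\setminus\{e\})\setminus S$, the set $S$ is a signature set for an $(n,k)$-equiangular frame if $Q=\sum_{g\in S}\lambda(g)-\sum_{h\in T}\lambda(h)$ is the signature matrix of an $(n,k)$-equiangular frame. *)

theory Defs
  imports
    "HOL-Analysis.Analysis"
    "HOL-Algebra.Coset"
    "Jordan_Normal_Form.Schur_Decomposition"
begin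

text \<open>
  \<open>\<complex>\<^sup>k\<close> is \<open>carrier_vec k\<close>. The inner product \<open>\<langle>x, y\<rangle>\<close> is \<open>x \<bullet>c y\<close>, which is linear in \<open>x\<close>
  and conjugate-linear in \<open>y\<close>. Frames are families indexed by \<open>{..<n}\<close>, so vectors may repeat.
\<close>

definition cvec_norm :: "complex vec \<Rightarrow> real" where
  "cvec_norm x = sqrt (Re (x \<bullet>c x))"

definition parseval_frame :: "nat \<Rightarrow> nat \<Rightarrow> (nat \<Rightarrow> complex vec) \<Rightarrow> bool" where
  "parseval_frame n k f \<longleftrightarrow>
     (\<forall>j<n. f j \<in> carrier_vec k) \<and>
     (\<forall>x\<in>carrier_vec k. (\<Sum>j<n. (cmod (x \<bullet>c f j))\<^sup>2) = (cvec_norm x)\<^sup>2)"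

definition normalize_cvec :: "complex vec \<Rightarrow> complex vec" where
  "normalize_cvec x = complex_of_real (1 / cvec_norm x) \<cdot>\<^sub>v x"

definition equiangular_frame :: "nat \<Rightarrow> nat \<Rightarrow> (nat \<Rightarrow> complex vec) \<Rightarrow> bool" where
  "equiangular_frame n k f \<longleftrightarrow>
     parseval_frame n k f \<and>
     (\<forall>i<n. f i \<noteq> 0\<^sub>v k) \<and>
     (\<exists>b::real. \<forall>i<n. \<forall>j<n. i \<noteq> j \<longrightarrow>
        cmod (normalize_cvec (f i) \<bullet>c normalize_cvec (f j)) = b)"

definition gram_matrix :: "nat \<Rightarrow> (nat \<Rightarrow> complex vec) \<Rightarrow> complex mat" where
  "gram_matrix n f = mat n n (\<lambda>(i, j). f j \<bullet>c f i)"

definition frame_const :: "nat \<Rightarrow> nat \<Rightarrow> real" where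
  "frame_const n k = sqrt (real k * (real n - real k) / ((real n)\<^sup>2 * (real n - 1)))"

definition is_signature_matrix :: "nat \<Rightarrow> nat \<Rightarrow> complex mat \<Rightarrow> bool" where
  "is_signature_matrix n k Q \<longleftrightarrow>
     1 \<le> k \<and> k < n \<and>
     Q \<in> carrier_mat n n \<and>
     mat_adjoint Q = Q \<and>
     (\<forall>i<n. Q $$ (i, i) = 0) \<and>
     (\<forall>i<n. \<forall>j<n. i \<noteq> j \<longrightarrow> cmod (Q $$ (i, j)) = 1) \<and>
     (\<exists>f. equiangular_frame n k f \<and>
        gram_matrix n f =
          complex_of_real (real k / real n) \<cdot>\<^sub>m 1\<^sub>m n + complex_of_real (frame_const n k) \<cdot>\<^sub>m Q)"

definition frame_dim :: "nat \<Rightarrow> real \<Rightarrow> real" where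
  "frame_dim n \<mu> = real n / 2 - \<mu> * real n / (2 * sqrt (4 * (real n - 1) + \<mu>\<^sup>2))"

definition prod_count :: "('a, 'b) monoid_scheme \<Rightarrow> 'a set \<Rightarrow> 'a set \<Rightarrow> 'a \<Rightarrow> nat" where
  "prod_count G A B g = card {(a, b). a \<in> A \<and> b \<in> B \<and> a \<otimes>\<^bsub>G\<^esub> b = g}"

text \<open>
  The matrices \<open>\<lambda>(g)\<close> are written in the ordered basis \<open>e\<^bsub>h 0\<^esub>, e\<^bsub>h 1\<^esub>, \<dots>\<close> given by an
  enumeration \<open>h\<close> of the group (a bijection from \<open>{..<order G}\<close> to \<open>carrier G\<close>):
  column \<open>j\<close> is the image of the basis vector of \<open>h j\<close>, that is, the basis vector of \<open>g \<otimes> h j\<close>.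
\<close>

definition left_regular :: "('a, 'b) monoid_scheme \<Rightarrow> (nat \<Rightarrow> 'a) \<Rightarrow> 'a \<Rightarrow> complex mat" where
  "left_regular G h g =
     mat (order G) (order G) (\<lambda>(i, j). if h i = g \<otimes>\<^bsub>G\<^esub> h j then 1 else 0)"

text \<open>Matrix sums are \<open>finsum\<close> in \<open>ring_mat\<close>, since \<open>complex mat\<close> has no type-class zero.\<close>

definition signature_sum ::
    "('a, 'b) monoid_scheme \<Rightarrow> (nat \<Rightarrow> 'a) \<Rightarrow> 'a set \<Rightarrow> 'a set \<Rightarrow> complex mat" where
  "signature_sum G h S T =
     finsum (ring_mat TYPE(complex) (order G) ()) (left_regular G h) S
     - finsum (ring_mat TYPE(complex) (order G) ()) (left_regular G h) T"

definition is_signature_set ::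
    "('a, 'b) monoid_scheme \<Rightarrow> (nat \<Rightarrow> 'a) \<Rightarrow> 'a set \<Rightarrow> nat \<Rightarrow> bool" where
  "is_signature_set G h S k \<longleftrightarrow>
     S \<subseteq> carrier G - {\<one>\<^bsub>G\<^esub>} \<and>
     is_signature_matrix (order G) k
       (signature_sum G h S ((carrier G - {\<one>\<^bsub>G\<^esub>}) - S))"

definition is_signature_set_at ::
    "('a, 'b) monoid_scheme \<Rightarrow> (nat \<Rightarrow> 'a) \<Rightarrow> 'a set \<Rightarrow> real \<Rightarrow> bool" where
  "is_signature_set_at G h S \<mu> \<longleftrightarrow>
     (\<exists>k::nat. real k = frame_dim (order G) \<mu> \<and> is_signature_set G h S k)"

end

theory Submission
  imports Defs
begin

text \<open>
  Put \<open>s = sqrt (4 (n - 1) + \<mu>\<^sup>2)\<close>. When \<open>k\<close> is \<open>frame_dim n \<mu>\<close>, the coefficients in the prescribed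
  Gram matrix simplify to \<open>k / n = (1 - \<mu> / s) / 2\<close> and \<open>frame_const n k = 1 / s\<close>. The Gram matrices
  of Parseval frames are exactly the Hermitian projections, so \<open>Q\<close> is a signature matrix if and
  only if \<open>P = (k / n) I + (1 / s) Q\<close> is idempotent. Expanding \<open>P\<^sup>2 = P\<close> turns this condition into the
  quadratic equation \<open>Q\<^sup>2 = (n - 1) I + \<mu> Q\<close> (\<open>signature_matrix_iff_quadratic\<close>).
  The dimension takes care of itself: if \<open>Q\<close> solves the equation, then the trace of \<open>P\<close> is
  \<open>frame_dim n \<mu>\<close>, and it is a natural number because it is the rank of a projection
  (\<open>hermitian_projection_imp_parseval_gram\<close>).

  For \<open>Q = \<Sum>g\<in>S. \<lambda>(g) - \<Sum>g\<in>T. \<lambda>(g)\<close> the \<open>(i, j)\<close> entry is \<open>\<chi> (h i \<otimes> inv (h j))\<close>, where \<open>\<chi>\<close> is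
  \<open>1\<close> on \<open>S\<close>, \<open>-1\<close> on \<open>T\<close> and \<open>0\<close> at the identity. Hence \<open>Q\<^sup>2\<close> is given in the same way by the
  convolution \<open>\<chi> * \<chi>\<close>, whose value at the identity is always \<open>n - 1\<close>, and the quadratic equation says
  \<open>(\<chi> * \<chi>) g = \<mu> \<chi> g\<close> for all \<open>g \<noteq> \<one>\<close> (\<open>signature_set_iff_convolution\<close>).
  Finally the convolution counts factorizations: for \<open>g \<noteq> \<one>\<close>, each of the \<open>n - 2\<close> ways to write \<open>g\<close>
  as a product of two elements other than \<open>\<one>\<close> contributes \<open>-1\<close> when it mixes \<open>S\<close> and \<open>T\<close> and \<open>1\<close>
  otherwise, and the mixed ones are equally often of type \<open>S T\<close> and \<open>T S\<close>, so
  \<open>(\<chi> * \<chi>) g = n - 2 - 4 N\<close> with \<open>N\<close> the number of factorizations of type \<open>S T\<close>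
  (\<open>prod_count_eq_convolution\<close>). Equating this with \<open>\<mu>\<close> or \<open>-\<mu>\<close> gives the two counts.
\<close>

unbundle no vec_syntax

section \<open>Inner products and Parseval frames\<close>

lemma sum_mult_cnj: "(\<Sum>i\<in>A. f i * cnj (f i)) = complex_of_real (\<Sum>i\<in>A. (cmod (f i))\<^sup>2)"
  by (simp add: complex_norm_square[symmetric])

lemma cscalar_prod_eq_sum:
  fixes x y :: "complex vec"
  assumes "x \<in> carrier_vec k" "y \<in> carrier_vec k"
  shows "x \<bullet>c y = (\<Sum>m<k. x $ m * cnj (y $ m))"
  using assms by (auto simp: scalar_prod_def atLeast0LessThan intro!: sum.cong)

lemma cscalar_prod_commute_cnj:
  fixes x y :: "complex vec"
  assumes "x \<in> carrier_vec k" "y \<in> carrier_vec k"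
  shows "y \<bullet>c x = cnj (x \<bullet>c y)"
  using assms by (simp add: cscalar_prod_eq_sum[of _ k] mult.commute)

lemma cscalar_prod_add_smult_left:
  fixes x y z :: "complex vec"
  assumes "x \<in> carrier_vec k" "y \<in> carrier_vec k" "z \<in> carrier_vec k"
  shows "(x + c \<cdot>\<^sub>v y) \<bullet>c z = x \<bullet>c z + c * (y \<bullet>c z)"
proof -
  have "x + c \<cdot>\<^sub>v y \<in> carrier_vec k" using assms by auto
  then have "(x + c \<cdot>\<^sub>v y) \<bullet>c z = (\<Sum>m<k. (x + c \<cdot>\<^sub>v y) $ m * cnj (z $ m))"
    using assms(3) by (rule cscalar_prod_eq_sum)
  also have "\<dots> = (\<Sum>m<k. x $ m * cnj (z $ m) + c * (y $ m * cnj (z $ m)))"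
    using assms by (intro sum.cong) (auto simp: algebra_simps)
  finally show ?thesis
    by (simp add: cscalar_prod_eq_sum[OF assms(1,3)] cscalar_prod_eq_sum[OF assms(2,3)]
        sum.distrib sum_distrib_left)
qed

lemma cvec_norm_square:
  assumes "x \<in> carrier_vec k"
  shows "complex_of_real ((cvec_norm x)\<^sup>2) = x \<bullet>c x"
proof -
  have *: "x \<bullet>c x = complex_of_real (\<Sum>m<k. (cmod (x $ m))\<^sup>2)"
    using assms by (simp add: cscalar_prod_eq_sum[of _ k] sum_mult_cnj)
  have "0 \<le> (\<Sum>m<k. (cmod (x $ m))\<^sup>2)" by (simp add: sum_nonneg)
  then have "(cvec_norm x)\<^sup>2 = (\<Sum>m<k. (cmod (x $ m))\<^sup>2)"
    unfolding cvec_norm_def * by simp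
  then show ?thesis using * by simp
qed

text \<open>
  The Parseval identity is the diagonal of a sesquilinear identity, which follows by polarization:
  the defect \<open>D\<close> vanishes at \<open>x\<close>, \<open>y\<close>, \<open>x + y\<close> and \<open>x + \<i> y\<close>. With \<open>x\<close> and \<open>y\<close> taken among the frame
  vectors, it says that the Gram matrix is idempotent.
\<close>

lemma parseval_reconstruction:
  assumes frame: "parseval_frame n k f"
    and x: "x \<in> carrier_vec k" and y: "y \<in> carrier_vec k"
  shows "(\<Sum>l<n. (x \<bullet>c f l) * (f l \<bullet>c y)) = x \<bullet>c y"
proof -
  define D where "D u v = (\<Sum>l<n. (u \<bullet>c f l) * cnj (v \<bullet>c f l)) - u \<bullet>c v" for u v
  have fc: "f l \<in> carrier_vec k" if "l < n" for l
    using frame that by (auto simp: parseval_frame_def)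
  have diag: "D u u = 0" if u: "u \<in> carrier_vec k" for u
  proof -
    have "(\<Sum>l<n. (u \<bullet>c f l) * cnj (u \<bullet>c f l)) = complex_of_real (\<Sum>l<n. (cmod (u \<bullet>c f l))\<^sup>2)"
      by (simp add: sum_mult_cnj)
    also have "\<dots> = complex_of_real ((cvec_norm u)\<^sup>2)"
      using frame u by (simp add: parseval_frame_def)
    also have "\<dots> = u \<bullet>c u" using u by (rule cvec_norm_square)
    finally show ?thesis by (simp add: D_def)
  qed
  have expand: "D (x + c \<cdot>\<^sub>v y) (x + c \<cdot>\<^sub>v y)
      = D x x + cnj c * D x y + c * D y x + c * cnj c * D y y" for c
  proof -
    let ?z = "x + c \<cdot>\<^sub>v y"
    have z: "?z \<in> carrier_vec k" using x y by auto
    have zl: "?z \<bullet>c v = x \<bullet>c v + c * (y \<bullet>c v)" if "v \<in> carrier_vec k" for v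
      using x y that by (rule cscalar_prod_add_smult_left)
    have zz: "?z \<bullet>c ?z = x \<bullet>c x + cnj c * (x \<bullet>c y) + c * (y \<bullet>c x) + c * cnj c * (y \<bullet>c y)"
      using cscalar_prod_commute_cnj[OF z x] cscalar_prod_commute_cnj[OF z y]
        cscalar_prod_commute_cnj[OF x x] cscalar_prod_commute_cnj[OF x y]
        cscalar_prod_commute_cnj[OF y y] zl[OF x] zl[OF y] zl[OF z]
      by (simp add: algebra_simps)
    have "(?z \<bullet>c f l) * cnj (?z \<bullet>c f l) =
        (x \<bullet>c f l) * cnj (x \<bullet>c f l) + cnj c * ((x \<bullet>c f l) * cnj (y \<bullet>c f l))
          + c * ((y \<bullet>c f l) * cnj (x \<bullet>c f l)) + c * cnj c * ((y \<bullet>c f l) * cnj (y \<bullet>c f l))"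
      if "l < n" for l
      unfolding zl[OF fc[OF that]] complex_cnj_add complex_cnj_mult
      by (simp only: ring_distribs mult_ac add_ac)
    then have "(\<Sum>l<n. (?z \<bullet>c f l) * cnj (?z \<bullet>c f l)) =
        (\<Sum>l<n. (x \<bullet>c f l) * cnj (x \<bullet>c f l)) + cnj c * (\<Sum>l<n. (x \<bullet>c f l) * cnj (y \<bullet>c f l))
          + c * (\<Sum>l<n. (y \<bullet>c f l) * cnj (x \<bullet>c f l))
          + c * cnj c * (\<Sum>l<n. (y \<bullet>c f l) * cnj (y \<bullet>c f l))"
      unfolding sum_distrib_left sum.distrib[symmetric] by (intro sum.cong) auto
    then show ?thesis unfolding D_def zz by (simp only: right_diff_distrib) simp
  qed
  have "D x y + D y x = 0"
    using expand[of 1] diag[OF x] diag[OF y] diag[of "x + 1 \<cdot>\<^sub>v y"] x y by simp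
  moreover have "D y x - D x y = 0"
    using expand[of \<i>] diag[OF x] diag[OF y] diag[of "x + \<i> \<cdot>\<^sub>v y"] x y
    by (simp add: algebra_simps)
  ultimately have "D x y = 0" by (simp add: complex_eq_iff)
  moreover have "(\<Sum>l<n. (x \<bullet>c f l) * (f l \<bullet>c y)) = (\<Sum>l<n. (x \<bullet>c f l) * cnj (y \<bullet>c f l))"
    by (rule sum.cong) (use y fc in \<open>auto simp: cscalar_prod_commute_cnj[OF y fc]\<close>)
  ultimately show ?thesis by (simp add: D_def)
qed

section \<open>Hermitian projections are Gram matrices\<close>

definition hermitian_projection :: "nat \<Rightarrow> (nat \<Rightarrow> nat \<Rightarrow> complex) \<Rightarrow> bool" where
  "hermitian_projection n P \<longleftrightarrow>
     (\<forall>i<n. \<forall>j<n. P j i = cnj (P i j)) \<and>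
     (\<forall>i<n. \<forall>j<n. (\<Sum>l<n. P i l * P l j) = P i j)"

lemma hermitian_projection_cnj:
  "hermitian_projection n P \<Longrightarrow> i < n \<Longrightarrow> j < n \<Longrightarrow> P j i = cnj (P i j)"
  unfolding hermitian_projection_def by blast

lemma hermitian_projection_idem:
  "hermitian_projection n P \<Longrightarrow> i < n \<Longrightarrow> j < n \<Longrightarrow> (\<Sum>l<n. P i l * P l j) = P i j"
  unfolding hermitian_projection_def by blast

text \<open>
  Since \<open>P = P P\<^sup>*\<close>, the trace is the squared Frobenius norm. This makes the trace real and
  nonnegative, and zero only for \<open>P = 0\<close>, so that it can serve as an induction measure.
\<close>

lemma hermitian_projection_trace:
  assumes "hermitian_projection n P"
  shows "(\<Sum>i<n. P i i) = complex_of_real (\<Sum>i<n. \<Sum>l<n. (cmod (P i l))\<^sup>2)"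
proof -
  have "P i i = complex_of_real (\<Sum>l<n. (cmod (P i l))\<^sup>2)" if i: "i < n" for i
  proof -
    have "P i i = (\<Sum>l<n. P i l * P l i)" using hermitian_projection_idem[OF assms i i] by simp
    also have "\<dots> = (\<Sum>l<n. P i l * cnj (P i l))"
      using hermitian_projection_cnj[OF assms i] by (intro sum.cong) auto
    finally show ?thesis by (simp add: sum_mult_cnj)
  qed
  then show ?thesis by simp
qed

text \<open>
  A unit vector \<open>w\<close> in the range of \<open>P\<close> splits off as the rank-one projection \<open>w w\<^sup>*\<close>; the remainder
  projects onto the orthogonal complement of \<open>w\<close> in the range, and in particular kills \<open>w\<close>.
\<close>

lemma hermitian_projection_remove_unit_vector:
  assumes P: "hermitian_projection n P"
    and fix_w: "\<And>i. i < n \<Longrightarrow> (\<Sum>l<n. P i l * w l) = w i"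
    and unit: "(\<Sum>i<n. w i * cnj (w i)) = 1"
  shows "hermitian_projection n (\<lambda>i j. P i j - w i * cnj (w j))" (is "hermitian_projection n ?R")
    and "\<And>i. i < n \<Longrightarrow> (\<Sum>l<n. (P i l - w i * cnj (w l)) * w l) = 0"
proof -
  have herm: "P j i = cnj (P i j)" if "i < n" "j < n" for i j
    using P that by (rule hermitian_projection_cnj)
  have idem: "(\<Sum>l<n. P i l * P l j) = P i j" if "i < n" "j < n" for i j
    using P that by (rule hermitian_projection_idem)
  have unit': "(\<Sum>i<n. cnj (w i) * w i) = 1" using unit by (simp add: mult.commute)
  have fix_w': "(\<Sum>l<n. cnj (w l) * P l j) = cnj (w j)" if "j < n" for j
  proof -
    have "(\<Sum>l<n. cnj (w l) * P l j) = cnj (\<Sum>l<n. P j l * w l)"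
      unfolding cnj_sum using herm[of j] that
      by (intro sum.cong) (simp_all add: mult.commute)
    then show ?thesis using fix_w[OF that] by simp
  qed
  have idem_R: "(\<Sum>l<n. ?R i l * ?R l j) = ?R i j" if "i < n" "j < n" for i j
  proof -
    have "(\<Sum>l<n. ?R i l * ?R l j) = (\<Sum>l<n. P i l * P l j) - (\<Sum>l<n. P i l * w l) * cnj (w j)
        - w i * (\<Sum>l<n. cnj (w l) * P l j) + w i * (\<Sum>l<n. cnj (w l) * w l) * cnj (w j)"
      by (simp add: sum_distrib_left sum_distrib_right sum.distrib sum_subtractf algebra_simps)
    then show ?thesis
      using idem that fix_w fix_w' unit' by simp
  qed
  show "hermitian_projection n ?R"
    unfolding hermitian_projection_def
  proof (intro conjI allI impI)
    show "?R j i = cnj (?R i j)" if "i < n" "j < n" for i j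
      using herm[OF that] by simp
  qed (rule idem_R)
  show "(\<Sum>l<n. (P i l - w i * cnj (w l)) * w l) = 0" if "i < n" for i
  proof -
    have "(\<Sum>l<n. (P i l - w i * cnj (w l)) * w l)
        = (\<Sum>l<n. P i l * w l) - w i * (\<Sum>l<n. cnj (w l) * w l)"
      by (simp add: sum_distrib_left sum_subtractf algebra_simps)
    then show ?thesis using fix_w[OF that] unit' by simp
  qed
qed

text \<open>
  An orthonormal basis of the range, found by splitting off one unit vector at a time. Each step
  lowers the trace by one, which ends the process and shows that the trace is the number of steps.
\<close>

lemma hermitian_projection_decomposition:
  assumes "hermitian_projection n P"
  shows "\<exists>r w. (\<Sum>i<n. P i i) = of_nat r
      \<and> (\<forall>i<n. \<forall>j<n. P i j = (\<Sum>m<r. w m i * cnj (w m j)))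
      \<and> (\<forall>m<r. \<forall>l<r. (\<Sum>i<n. w m i * cnj (w l i)) = (if m = l then 1 else 0))"
proof -
  define t where "t P = (\<Sum>i<n. \<Sum>l<n. (cmod (P i l :: complex))\<^sup>2)" for P
  have "hermitian_projection n P \<Longrightarrow> t P \<le> real N \<Longrightarrow> ?thesis" for N
  proof (induction N arbitrary: P)
    case (0 P)
    have "P i j = 0" if "i < n" "j < n" for i j
    proof -
      have "t P = 0" using 0 by (auto simp: t_def intro!: antisym sum_nonneg)
      then show ?thesis using that
        by (simp add: t_def sum_nonneg_eq_0_iff sum_nonneg)
    qed
    then show ?case by (intro exI[of _ 0]) auto
  next
    case (Suc N P)
    note P = Suc.prems(1)
    show ?case
    proof (cases "\<forall>i<n. \<forall>j<n. P i j = 0")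
      case True
      then show ?thesis by (intro exI[of _ 0]) auto
    next
      case False
      then obtain i0 j where ij: "i0 < n" "j < n" "P i0 j \<noteq> 0" by auto
      define a where "a = sqrt (\<Sum>i<n. (cmod (P i j))\<^sup>2)"
      have "(cmod (P i0 j))\<^sup>2 \<le> (\<Sum>i<n. (cmod (P i j))\<^sup>2)"
        using ij by (intro member_le_sum) auto
      then have apos: "a > 0" using ij by (auto simp: a_def intro: less_le_trans[rotated])
      have a2: "complex_of_real a * complex_of_real a = (\<Sum>i<n. P i j * cnj (P i j))"
      proof -
        have "a * a = (\<Sum>i<n. (cmod (P i j))\<^sup>2)"
          by (simp add: a_def sum_nonneg)
        then show ?thesis
          unfolding of_real_mult[symmetric] by (simp add: sum_mult_cnj)
      qed
      \<comment> \<open>Any nonzero column of \<open>P\<close> lies in its range, because \<open>P P = P\<close>.\<close>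
      define u where "u i = P i j / complex_of_real a" for i
      have fix_u: "(\<Sum>l<n. P i l * u l) = u i" if "i < n" for i
        using that ij by (simp add: u_def hermitian_projection_idem[OF P] sum_divide_distrib[symmetric])
      have unit_u: "(\<Sum>i<n. u i * cnj (u i)) = 1"
        using apos by (simp add: u_def sum_divide_distrib[symmetric] a2[symmetric])
      define R where "R i j = P i j - u i * cnj (u j)" for i j
      have R: "hermitian_projection n R"
        unfolding R_def by (rule hermitian_projection_remove_unit_vector(1)[OF P fix_u unit_u])
      have Ru: "(\<Sum>l<n. R i l * u l) = 0" if "i < n" for i
        unfolding R_def by (rule hermitian_projection_remove_unit_vector(2)[OF P fix_u unit_u that])
      have trace_R: "(\<Sum>i<n. P i i) = (\<Sum>i<n. R i i) + 1"
        using unit_u by (simp add: R_def sum_subtractf)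
      have "complex_of_real (t P) = complex_of_real (t R + 1)"
        using trace_R hermitian_projection_trace[OF P] hermitian_projection_trace[OF R]
        unfolding t_def by simp
      then have "t P = t R + 1" unfolding of_real_eq_iff .
      then have "t R \<le> real N" using Suc.prems(2) by simp
      from Suc.IH[OF R this] obtain r w where
        tr: "(\<Sum>i<n. R i i) = of_nat r"
        and dec: "\<And>i j. i < n \<Longrightarrow> j < n \<Longrightarrow> R i j = (\<Sum>m<r. w m i * cnj (w m j))"
        and orth: "\<And>m l. m < r \<Longrightarrow> l < r \<Longrightarrow>
            (\<Sum>i<n. w m i * cnj (w l i)) = (if m = l then 1 else 0)"
        by blast
      \<comment> \<open>The vectors \<open>w m\<close> lie in the range of \<open>R\<close>, and \<open>u\<close> lies in the kernel: test
        \<open>R u = 0\<close> against \<open>w m\<close> and use the orthonormality of the \<open>w q\<close>.\<close>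
      have uw: "(\<Sum>i<n. u i * cnj (w m i)) = 0" if m: "m < r" for m
      proof -
        have "(\<Sum>i<n. (\<Sum>l<n. R i l * u l) * cnj (w m i))
          = (\<Sum>i<n. \<Sum>l<n. \<Sum>q<r. w q i * cnj (w q l) * u l * cnj (w m i))"
          by (simp add: dec sum_distrib_right)
        also have "\<dots> = (\<Sum>q<r. \<Sum>l<n. \<Sum>i<n. w q i * cnj (w q l) * u l * cnj (w m i))"
        proof -
          have swap: "(\<Sum>i<n. \<Sum>l<n. \<Sum>q<r. F i l q) = (\<Sum>q<r. \<Sum>l<n. \<Sum>i<n. F i l q)"
            for F :: "nat \<Rightarrow> nat \<Rightarrow> nat \<Rightarrow> complex"
          proof -
            have "(\<Sum>i<n. \<Sum>l<n. \<Sum>q<r. F i l q) = (\<Sum>l<n. \<Sum>i<n. \<Sum>q<r. F i l q)"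
              by (rule sum.swap)
            also have "\<dots> = (\<Sum>l<n. \<Sum>q<r. \<Sum>i<n. F i l q)"
              by (intro sum.cong refl sum.swap)
            also have "\<dots> = (\<Sum>q<r. \<Sum>l<n. \<Sum>i<n. F i l q)"
              by (rule sum.swap)
            finally show ?thesis .
          qed
          show ?thesis by (rule swap)
        qed
        also have "\<dots> = (\<Sum>q<r. (\<Sum>l<n. cnj (w q l) * u l) * (\<Sum>i<n. w q i * cnj (w m i)))"
          by (simp add: sum_product mult_ac)
        also have "\<dots> = (\<Sum>q<r. if q = m then (\<Sum>l<n. cnj (w q l) * u l) else 0)"
          using m orth by (intro sum.cong) auto
        also have "\<dots> = (\<Sum>l<n. u l * cnj (w m l))" using m by (simp add: mult.commute)
        finally show ?thesis using Ru by simp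
      qed
      have wu: "(\<Sum>i<n. w m i * cnj (u i)) = 0" if "m < r" for m
        using arg_cong[OF uw[OF that], of cnj] by (simp add: mult.commute)
      define w' where "w' = w(r := u)"
      have "(\<Sum>i<n. P i i) = of_nat (Suc r)" using tr trace_R by simp
      moreover have "P i j = (\<Sum>m<Suc r. w' m i * cnj (w' m j))" if "i < n" "j < n" for i j
      proof -
        have "P i j = R i j + u i * cnj (u j)" by (simp add: R_def)
        then show ?thesis by (simp add: dec that w'_def)
      qed
      moreover have "(\<Sum>i<n. w' m i * cnj (w' l i)) = (if m = l then 1 else 0)"
        if "m < Suc r" "l < Suc r" for m l
        using that unit_u orth uw wu
        by (auto simp: w'_def less_Suc_eq)
      ultimately show ?thesis by blast
    qed
  qed
  moreover have "t P \<le> real (nat \<lceil>t P\<rceil>)" by linarith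
  ultimately show ?thesis using assms by blast
qed

text \<open>
  Write \<open>P = W W\<^sup>*\<close> with orthonormal columns. The conjugated rows of \<open>W\<close> are vectors of length \<open>k\<close> with
  Gram matrix \<open>W W\<^sup>*\<close>, and \<open>W\<^sup>* W = I\<close> is the Parseval property.
\<close>

lemma hermitian_projection_imp_parseval_gram:
  assumes "hermitian_projection n P"
  shows "\<exists>k f. (\<Sum>i<n. P i i) = of_nat k \<and> parseval_frame n k f
      \<and> (\<forall>i<n. \<forall>j<n. f j \<bullet>c f i = P i j)"
proof -
  obtain k w where
    tr: "(\<Sum>i<n. P i i) = of_nat k"
    and dec: "\<And>i j. i < n \<Longrightarrow> j < n \<Longrightarrow> P i j = (\<Sum>m<k. w m i * cnj (w m j))"
    and orth: "\<And>m l. m < k \<Longrightarrow> l < k \<Longrightarrow>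
        (\<Sum>i<n. w m i * cnj (w l i)) = (if m = l then 1 else 0)"
    using hermitian_projection_decomposition[OF assms] by blast
  define f where "f j = vec k (\<lambda>m. cnj (w m j))" for j
  have fc: "f j \<in> carrier_vec k" for j by (simp add: f_def)
  have "(\<Sum>j<n. (cmod (x \<bullet>c f j))\<^sup>2) = (cvec_norm x)\<^sup>2" if x: "x \<in> carrier_vec k" for x
  proof -
    have xf: "x \<bullet>c f j = (\<Sum>m<k. x $ m * w m j)" for j
      by (simp add: cscalar_prod_eq_sum[OF x fc]) (simp add: f_def)
    have "complex_of_real (\<Sum>j<n. (cmod (x \<bullet>c f j))\<^sup>2)
        = (\<Sum>j<n. (x \<bullet>c f j) * cnj (x \<bullet>c f j))"
      by (simp add: sum_mult_cnj)
    also have "\<dots> = (\<Sum>j<n. \<Sum>m<k. \<Sum>l<k. x $ m * cnj (x $ l) * (w m j * cnj (w l j)))"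
      unfolding xf by (simp add: sum_product mult_ac)
    also have "\<dots> = (\<Sum>m<k. \<Sum>l<k. \<Sum>j<n. x $ m * cnj (x $ l) * (w m j * cnj (w l j)))"
      by (subst sum.swap, rule sum.cong[OF refl], rule sum.swap)
    also have "\<dots> = (\<Sum>m<k. \<Sum>l<k. if m = l then x $ m * cnj (x $ l) else 0)"
      unfolding sum_distrib_left[symmetric] by (intro sum.cong refl) (simp add: orth)
    also have "\<dots> = x \<bullet>c x" by (simp add: cscalar_prod_eq_sum[OF x x])
    also have "\<dots> = complex_of_real ((cvec_norm x)\<^sup>2)" using cvec_norm_square[OF x] by simp
    finally show ?thesis unfolding of_real_eq_iff .
  qed
  then have "parseval_frame n k f" using fc by (simp add: parseval_frame_def)
  moreover have "f j \<bullet>c f i = P i j" if "i < n" "j < n" for i j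
    unfolding cscalar_prod_eq_sum[OF fc fc]
    using dec[OF that] by (simp add: f_def mult.commute)
  ultimately show ?thesis using tr by blast
qed

section \<open>Signature matrices and the quadratic equation\<close>

lemma mat_adjoint_eq_self_iff:
  assumes Q: "Q \<in> carrier_mat n n"
  shows "mat_adjoint Q = Q \<longleftrightarrow> (\<forall>i<n. \<forall>j<n. Q $$ (j, i) = cnj (Q $$ (i, j :: nat)))"
proof -
  have entry: "mat_adjoint Q $$ (i, j) = cnj (Q $$ (j, i))" if "i < n" "j < n" for i j
    using Q that by (simp add: mat_adjoint_def mat_of_rows_index)
  show ?thesis
  proof
    assume "mat_adjoint Q = Q"
    then show "\<forall>i<n. \<forall>j<n. Q $$ (j, i) = cnj (Q $$ (i, j))" using entry by metis
  next
    assume herm: "\<forall>i<n. \<forall>j<n. Q $$ (j, i) = cnj (Q $$ (i, j))"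
    show "mat_adjoint Q = Q"
    proof (rule eq_matI)
      show "mat_adjoint Q $$ (i, j) = Q $$ (i, j)" if "i < dim_row Q" "j < dim_col Q" for i j
        using that herm entry[of i j] Q by (metis carrier_matD)
    qed (use Q in \<open>simp_all add: mat_adjoint_def\<close>)
  qed
qed

text \<open>
  Write \<open>P = a I + c Q\<close> with \<open>a = (1 - \<mu> / s) / 2\<close> and \<open>c = 1 / s\<close>. Then \<open>a - a\<^sup>2 = c\<^sup>2 (n - 1)\<close> and
  \<open>c - 2 a c = c\<^sup>2 \<mu>\<close>, so \<open>P\<^sup>2 - P = c\<^sup>2 (Q\<^sup>2 - (n - 1) I - \<mu> Q)\<close>.
\<close>

lemma idempotent_pencil_iff_quadratic:
  fixes q :: "nat \<Rightarrow> nat \<Rightarrow> complex" and \<mu> :: real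
  assumes n: "n \<ge> 2"
  defines "s \<equiv> sqrt (4 * (real n - 1) + \<mu>\<^sup>2)"
  defines "P \<equiv> \<lambda>i j. complex_of_real ((1 - \<mu> / s) / 2) * (if i = j then 1 else 0)
                 + complex_of_real (1 / s) * q i j"
  assumes ij: "i < n" "j < n"
  shows "(\<Sum>l<n. P i l * P l j) = P i j
      \<longleftrightarrow> (\<Sum>l<n. q i l * q l j)
          = complex_of_real (real n - 1) * (if i = j then 1 else 0) + complex_of_real \<mu> * q i j"
proof -
  have s2: "s\<^sup>2 = 4 * (real n - 1) + \<mu>\<^sup>2" and spos: "s > 0"
    using n by (auto simp: s_def intro: add_pos_nonneg)
  define a c where "a = complex_of_real ((1 - \<mu> / s) / 2)" and "c = complex_of_real (1 / s)"
  define d :: "nat \<Rightarrow> nat \<Rightarrow> complex" where "d i j = (if i = j then 1 else 0)" for i j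
  have dsum: "(\<Sum>l<n. d i l * v l) = v i" "(\<Sum>l<n. v l * d l j) = v j" for v
    using ij by (simp_all add: d_def if_distrib if_distribR cong: if_cong)
  have "(\<Sum>l<n. P i l * P l j) = (\<Sum>l<n. a * a * (d i l * d l j) + a * c * (d i l * q l j)
        + a * c * (q i l * d l j) + c * c * (q i l * q l j))"
    unfolding P_def a_def[symmetric] c_def[symmetric] d_def[symmetric]
    by (intro sum.cong) (simp_all only: ring_distribs mult_ac add_ac)
  also have "\<dots> = a * a * (\<Sum>l<n. d i l * d l j) + a * c * (\<Sum>l<n. d i l * q l j)
        + a * c * (\<Sum>l<n. q i l * d l j) + c * c * (\<Sum>l<n. q i l * q l j)"
    by (simp only: sum.distrib sum_distrib_left)
  finally have PP: "(\<Sum>l<n. P i l * P l j)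
      = a * a * d i j + 2 * a * c * q i j + c * c * (\<Sum>l<n. q i l * q l j)"
    unfolding dsum by (simp add: algebra_simps)
  have aa: "a * a = a - c * c * complex_of_real (real n - 1)"
  proof -
    have r: "real n - 1 = (s\<^sup>2 - \<mu>\<^sup>2) / 4" using s2 by simp
    have "(1 - \<mu> / s) / 2 * ((1 - \<mu> / s) / 2) = (1 - \<mu> / s) / 2 - 1 / s * (1 / s) * (real n - 1)"
      unfolding r using spos by (simp add: field_simps power2_eq_square)
    then show ?thesis unfolding a_def c_def of_real_mult[symmetric] of_real_diff[symmetric] by simp
  qed
  have ac: "2 * a * c = c - c * c * complex_of_real \<mu>"
  proof -
    have "2 * ((1 - \<mu> / s) / 2) * (1 / s) = 1 / s - 1 / s * (1 / s) * \<mu>"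
      using spos by (simp add: field_simps)
    then have "complex_of_real (2 * ((1 - \<mu> / s) / 2) * (1 / s))
        = complex_of_real (1 / s - 1 / s * (1 / s) * \<mu>)" by simp
    then show ?thesis unfolding a_def c_def by simp
  qed
  have P_ij: "P i j = a * d i j + c * q i j"
    by (simp only: P_def a_def c_def d_def)
  have "(\<Sum>l<n. P i l * P l j) - P i j = c * c *
      ((\<Sum>l<n. q i l * q l j) - (complex_of_real (real n - 1) * d i j + complex_of_real \<mu> * q i j))"
    unfolding PP aa ac P_ij by (simp only: algebra_simps)
  moreover have "c * c \<noteq> 0" using spos by (simp add: c_def)
  ultimately show ?thesis unfolding d_def by (metis (no_types, lifting) mult_eq_0_iff right_minus_eq)
qed

text \<open>
  Strict because \<open>s > \<bar>\<mu>\<bar>\<close> for \<open>n \<ge> 2\<close>; a natural number \<open>k\<close> equal to \<open>frame_dim n \<mu>\<close> therefore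
  satisfies \<open>1 \<le> k < n\<close> automatically.
\<close>

lemma frame_dim_bounds:
  assumes "n \<ge> 2"
  shows "0 < frame_dim n \<mu>" "frame_dim n \<mu> < n"
proof -
  let ?s = "sqrt (4 * (real n - 1) + \<mu>\<^sup>2)"
  have "sqrt (\<mu>\<^sup>2) < ?s" using assms by (intro real_sqrt_less_mono) simp
  then have "\<bar>\<mu>\<bar> < ?s" by simp
  moreover from this have "0 < ?s" using abs_ge_zero le_less_trans by blast
  ultimately have "\<bar>\<mu> / ?s\<bar> < 1" by (simp only: abs_divide abs_of_pos divide_less_eq_1_pos)
  then have "\<mu> / ?s < 1" "0 < 1 + \<mu> / ?s" unfolding abs_less_iff by linarith+
  moreover have eq: "frame_dim n \<mu> = real n * (1 - \<mu> / ?s) / 2"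
    by (simp add: frame_dim_def field_simps)
  ultimately show "0 < frame_dim n \<mu>" "frame_dim n \<mu> < n"
    using assms mult_pos_pos[of "real n" "1 - \<mu> / ?s"] mult_pos_pos[of "real n" "1 + \<mu> / ?s"]
    by (simp_all add: eq algebra_simps)
qed

lemma frame_dim_over_n:
  assumes "n \<ge> 2"
  shows "frame_dim n \<mu> / n = (1 - \<mu> / sqrt (4 * (real n - 1) + \<mu>\<^sup>2)) / 2"
  using assms by (simp add: frame_dim_def field_simps)

lemma frame_const_frame_dim:
  assumes n: "n \<ge> 2" and k: "real k = frame_dim n \<mu>"
  shows "frame_const n k = 1 / sqrt (4 * (real n - 1) + \<mu>\<^sup>2)"
proof -
  define s where "s = sqrt (4 * (real n - 1) + \<mu>\<^sup>2)"
  have s2: "s\<^sup>2 = 4 * (real n - 1) + \<mu>\<^sup>2" and spos: "s > 0"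
    using n by (auto simp: s_def intro: add_pos_nonneg)
  have kn: "real k = real n * ((1 - \<mu> / s) / 2)"
    using frame_dim_over_n[OF n, of \<mu>] n k unfolding s_def by (simp add: field_simps)
  have kn': "real k = real n * (1 / 2 - (\<mu> / s) / 2)" using kn by (simp add: diff_divide_distrib)
  have "real k * (real n - real k) = (real n)\<^sup>2 * ((1 - (\<mu> / s)\<^sup>2) / 4)"
    by (simp add: kn' algebra_simps power2_eq_square)
  also have "(1 - (\<mu> / s)\<^sup>2) / 4 = (s\<^sup>2 - \<mu>\<^sup>2) / 4 / s\<^sup>2"
    using spos by (simp add: field_simps)
  also have "(s\<^sup>2 - \<mu>\<^sup>2) / 4 = real n - 1" using s2 by simp
  finally have eq: "real k * (real n - real k) = (real n)\<^sup>2 * ((real n - 1) / s\<^sup>2)" .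
  have "real k * (real n - real k) / ((real n)\<^sup>2 * (real n - 1)) = (1 / s)\<^sup>2"
    unfolding eq using n by (simp add: power_divide)
  then show ?thesis using spos unfolding frame_const_def s_def[symmetric] by simp
qed

lemma normalized_cscalar_prod:
  assumes "x \<in> carrier_vec k" "y \<in> carrier_vec k"
  shows "cmod (normalize_cvec x \<bullet>c normalize_cvec y) = cmod (x \<bullet>c y) / (cvec_norm x * cvec_norm y)"
proof -
  have nonneg: "0 \<le> cvec_norm z" if "z \<in> carrier_vec k" for z
  proof -
    have "0 \<le> (cvec_norm z)\<^sup>2" by (rule zero_le_power2)
    also have "(cvec_norm z)\<^sup>2 = Re (z \<bullet>c z)"
      unfolding cvec_norm_square[OF that, symmetric] by simp
    finally show ?thesis unfolding cvec_norm_def by simp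
  qed
  have "normalize_cvec x \<bullet>c normalize_cvec y
      = complex_of_real (1 / cvec_norm x) * complex_of_real (1 / cvec_norm y) * (x \<bullet>c y)"
    unfolding normalize_cvec_def using assms
    by (simp add: cscalar_prod_eq_sum[of _ k] sum_distrib_left algebra_simps)
  then show ?thesis using nonneg assms by (simp add: norm_mult norm_divide)
qed

text \<open>
  Equiangularity comes for free: the Gram matrix has the constant diagonal \<open>k / n > 0\<close> and
  off-diagonal entries of the constant modulus \<open>1 / s\<close>. What remains is whether the prescribed
  matrix is a Gram matrix of a Parseval frame at all, that is, a projection. In the backward
  direction the dimension of the frame is only known as the trace of the projection, and the zero
  diagonal of \<open>Q\<close> identifies that trace as \<open>frame_dim n \<mu>\<close>.
\<close>

lemma signature_matrix_iff_quadratic: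
  assumes n: "n \<ge> 2" and Q: "Q \<in> carrier_mat n n" and adj: "mat_adjoint Q = Q"
    and diag: "\<And>i. i < n \<Longrightarrow> Q $$ (i, i) = 0"
    and unimod: "\<And>i j. i < n \<Longrightarrow> j < n \<Longrightarrow> i \<noteq> j \<Longrightarrow> cmod (Q $$ (i, j)) = 1"
  shows "(\<exists>k. real k = frame_dim n \<mu> \<and> is_signature_matrix n k Q)
    \<longleftrightarrow> (\<forall>i<n. \<forall>j<n. (\<Sum>l<n. Q $$ (i, l) * Q $$ (l, j))
          = complex_of_real (real n - 1) * (if i = j then 1 else 0)
            + complex_of_real \<mu> * Q $$ (i, j))" (is "?frame \<longleftrightarrow> ?quad")
proof -
  define s where "s = sqrt (4 * (real n - 1) + \<mu>\<^sup>2)"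
  define a where "a = (1 - \<mu> / s) / 2"
  define P where "P i j = complex_of_real a * (if i = j then 1 else 0)
      + complex_of_real (1 / s) * Q $$ (i, j)" for i j
  have a: "a = frame_dim n \<mu> / n" using frame_dim_over_n[OF n] by (simp add: a_def s_def)
  have apos: "a > 0" using frame_dim_bounds[OF n] n by (simp add: a)
  have quad_iff: "?quad \<longleftrightarrow> (\<forall>i<n. \<forall>j<n. (\<Sum>l<n. P i l * P l j) = P i j)"
    using idempotent_pencil_iff_quadratic[OF n, where q = "\<lambda>i j. Q $$ (i, j)" and \<mu> = \<mu>]
    unfolding P_def a_def s_def by auto
  have gram: "gram_matrix n f = complex_of_real (real k / real n) \<cdot>\<^sub>m 1\<^sub>m n
        + complex_of_real (frame_const n k) \<cdot>\<^sub>m Q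
      \<longleftrightarrow> (\<forall>i<n. \<forall>j<n. f j \<bullet>c f i = P i j)" if k: "real k = frame_dim n \<mu>" for k f
  proof -
    have "real k / real n = a" "frame_const n k = 1 / s"
      using k a frame_const_frame_dim[OF n k] by (simp_all add: s_def)
    then show ?thesis using Q
      by (auto simp: mat_eq_iff gram_matrix_def P_def)
  qed
  show ?thesis
  proof
    assume ?frame
    then obtain k where k: "real k = frame_dim n \<mu>" and "is_signature_matrix n k Q" by blast
    then obtain f where f: "parseval_frame n k f"
      and "gram_matrix n f = complex_of_real (real k / real n) \<cdot>\<^sub>m 1\<^sub>m n
        + complex_of_real (frame_const n k) \<cdot>\<^sub>m Q"
      unfolding is_signature_matrix_def equiangular_frame_def by blast
    then have fP: "f j \<bullet>c f i = P i j" if "i < n" "j < n" for i j using gram[OF k] that by blast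
    have fc: "f l \<in> carrier_vec k" if "l < n" for l
      using f that by (simp add: parseval_frame_def)
    have "(\<Sum>l<n. P i l * P l j) = P i j" if ij: "i < n" "j < n" for i j
    proof -
      have "(\<Sum>l<n. P i l * P l j) = (\<Sum>l<n. (f j \<bullet>c f l) * (f l \<bullet>c f i))"
        using ij by (intro sum.cong) (simp_all add: fP mult.commute)
      then show ?thesis
        using parseval_reconstruction[OF f fc[OF ij(2)] fc[OF ij(1)]] fP[OF ij] by simp
    qed
    then show ?quad unfolding quad_iff by blast
  next
    assume ?quad
    moreover have "P j i = cnj (P i j)" if "i < n" "j < n" for i j
    proof -
      have "Q $$ (j, i) = cnj (Q $$ (i, j))"
        using adj that mat_adjoint_eq_self_iff[OF Q] by blast
      then show ?thesis by (simp add: P_def)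
    qed
    ultimately have "hermitian_projection n P"
      unfolding quad_iff hermitian_projection_def by blast
    then obtain k f where tr: "(\<Sum>i<n. P i i) = of_nat k" and f: "parseval_frame n k f"
      and fP: "\<And>i j. i < n \<Longrightarrow> j < n \<Longrightarrow> f j \<bullet>c f i = P i j"
      using hermitian_projection_imp_parseval_gram by blast
    have fc: "f l \<in> carrier_vec k" if "l < n" for l
      using f that by (simp add: parseval_frame_def)
    have "(\<Sum>i<n. P i i) = complex_of_real (real n * a)" by (simp add: P_def diag)
    then have "complex_of_real (real k) = complex_of_real (real n * a)" using tr by simp
    then have k: "real k = frame_dim n \<mu>" unfolding of_real_eq_iff using n by (simp add: a)
    then have kbounds: "1 \<le> k" "k < n" using frame_dim_bounds[OF n, of \<mu>] by linarith+
    have norm_f: "f i \<bullet>c f i = complex_of_real a" if "i < n" for i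
      using fP[OF that that] diag[OF that] by (simp add: P_def)
    have nonzero: "f i \<noteq> 0\<^sub>v k" if "i < n" for i
      using norm_f[OF that] apos by auto
    have "cmod (normalize_cvec (f i) \<bullet>c normalize_cvec (f j)) = 1 / s / a"
      if "i < n" "j < n" "i \<noteq> j" for i j
    proof -
      have "cvec_norm (f l) = sqrt a" if "l < n" for l
        unfolding cvec_norm_def norm_f[OF that] by simp
      moreover have "cmod (f i \<bullet>c f j) = 1 / s"
        using that fP[of j i] unimod[of j i] n
        by (simp add: P_def s_def norm_mult norm_divide)
      ultimately show ?thesis
        using that apos by (simp add: normalized_cscalar_prod[OF fc fc])
    qed
    then have "equiangular_frame n k f"
      using f nonzero unfolding equiangular_frame_def by blast
    moreover have "gram_matrix n f = complex_of_real (real k / real n) \<cdot>\<^sub>m 1\<^sub>m n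
        + complex_of_real (frame_const n k) \<cdot>\<^sub>m Q"
      using gram[OF k] fP by blast
    ultimately show ?frame
      using k kbounds Q adj diag unimod unfolding is_signature_matrix_def by blast
  qed
qed

section \<open>The signed sum of the regular representation\<close>

lemma finsum_ring_mat_index:
  fixes F :: "'c \<Rightarrow> 'd :: comm_ring_1 mat"
  assumes "finite A" "\<And>x. x \<in> A \<Longrightarrow> F x \<in> carrier_mat n n" "i < n" "j < n"
  shows "finsum (ring_mat TYPE('d) n ()) F A \<in> carrier_mat n n
    \<and> finsum (ring_mat TYPE('d) n ()) F A $$ (i, j) = (\<Sum>x\<in>A. F x $$ (i, j))"
proof -
  interpret R: ring "ring_mat TYPE('d) n ()" by (rule ring_mat)
  show ?thesis
    using assms(1,2)
  proof (induction A rule: finite_induct)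
    case empty
    show ?case using assms by (simp add: ring_mat_simps)
  next
    case (insert x A)
    then show ?case using assms(3,4) by (subst R.finsum_insert) (auto simp: ring_mat_simps)
  qed
qed

definition sign_of :: "'a set \<Rightarrow> 'a set \<Rightarrow> 'a \<Rightarrow> real" where
  "sign_of S T g = (if g \<in> S then 1 else if g \<in> T then -1 else 0)"

context group
begin

lemma signature_sum_index:
  assumes fin: "finite (carrier G)" and h: "bij_betw h {..<order G} (carrier G)"
    and S: "S \<subseteq> carrier G" and T: "T \<subseteq> carrier G" and disj: "S \<inter> T = {}"
    and ij: "i < order G" "j < order G"
  shows "signature_sum G h S T \<in> carrier_mat (order G) (order G)"
    and "signature_sum G h S T $$ (i, j) = complex_of_real (sign_of S T (h i \<otimes> inv (h j)))"
proof -
  let ?R = "ring_mat TYPE(complex) (order G) ()"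
  have hc: "h i \<in> carrier G" "h j \<in> carrier G" using h ij by (auto simp: bij_betw_def)
  have entry: "finsum ?R (left_regular G h) A \<in> carrier_mat (order G) (order G)"
    "finsum ?R (left_regular G h) A $$ (i, j) = (if h i \<otimes> inv (h j) \<in> A then 1 else 0)"
    if A: "A \<subseteq> carrier G" for A
  proof -
    have finA: "finite A" using A fin finite_subset by blast
    have eq: "h i = g \<otimes> h j \<longleftrightarrow> g = h i \<otimes> inv (h j)" if "g \<in> A" for g
      using A hc that by (metis inv_solve_right subsetD)
    note * = finsum_ring_mat_index[OF finA _ ij, of "left_regular G h"]
    show "finsum ?R (left_regular G h) A \<in> carrier_mat (order G) (order G)"
      using * by (simp add: left_regular_def)
    have "finsum ?R (left_regular G h) A $$ (i, j) = (\<Sum>g\<in>A. left_regular G h g $$ (i, j))"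
      using * by (simp add: left_regular_def)
    also have "\<dots> = (\<Sum>g\<in>A. if g = h i \<otimes> inv (h j) then 1 else 0)"
      using ij eq by (intro sum.cong) (auto simp: left_regular_def)
    finally show "finsum ?R (left_regular G h) A $$ (i, j) = (if h i \<otimes> inv (h j) \<in> A then 1 else 0)"
      using finA by simp
  qed
  show "signature_sum G h S T \<in> carrier_mat (order G) (order G)"
    using entry(1)[OF T] by (simp add: signature_sum_def minus_carrier_mat)
  show "signature_sum G h S T $$ (i, j) = complex_of_real (sign_of S T (h i \<otimes> inv (h j)))"
    using entry[OF S] entry[OF T] ij disj
    by (auto simp: signature_sum_def sign_of_def)
qed

lemma sum_translate_inverse:
  assumes "g \<in> carrier G"
  shows "(\<Sum>a\<in>carrier G. F (inv a \<otimes> g)) = (\<Sum>a\<in>carrier G. F a)"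
  using assms
  by (intro sum.reindex_bij_witness[of _ "\<lambda>a. g \<otimes> inv a" "\<lambda>a. inv a \<otimes> g"])
     (simp_all add: inv_mult_group m_assoc[symmetric], simp_all add: m_assoc)

text \<open>
  For \<open>a \<notin> {\<one>, g}\<close> both \<open>a\<close> and \<open>b = inv a \<otimes> g\<close> lie in \<open>S \<union> T\<close>, and \<open>(1 + \<chi> a) (1 - \<chi> b) / 4\<close> is the
  indicator of \<open>a \<in> S\<close> and \<open>b \<in> T\<close>. In the sum over \<open>a\<close> the linear terms cancel, because
  \<open>a \<mapsto> inv a \<otimes> g\<close> permutes \<open>carrier G - {\<one>, g}\<close>.
\<close>

lemma prod_count_eq_convolution:
  assumes fin: "finite (carrier G)"
    and S: "S \<subseteq> carrier G - {\<one>}" and T: "T = (carrier G - {\<one>}) - S"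
    and g: "g \<in> carrier G" "g \<noteq> \<one>"
  shows "4 * real (prod_count G S T g)
    = real (order G) - 2 - (\<Sum>a\<in>carrier G. sign_of S T a * sign_of S T (inv a \<otimes> g))"
proof -
  let ?\<chi> = "sign_of S T"
  define C where "C = carrier G - {\<one>, g}"
  have \<chi>1: "?\<chi> \<one> = 0" using S T by (auto simp: sign_of_def)
  have split: "(\<Sum>a\<in>carrier G. F a) = F \<one> + F g + (\<Sum>a\<in>C. F a)" for F :: "'a \<Rightarrow> real"
    using fin g by (simp add: C_def sum.remove[of _ \<one>] sum.remove[of _ g]
        Diff_insert[of _ _ "{\<one>}"] Diff_insert2[symmetric])
  have "card {(a, b). a \<in> S \<and> b \<in> T \<and> a \<otimes> b = g} = card {a \<in> C. a \<in> S \<and> inv a \<otimes> g \<in> T}"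
  proof (rule bij_betw_same_card[of fst], rule bij_betwI[where g = "\<lambda>a. (a, inv a \<otimes> g)"])
    show "fst \<in> {(a, b). a \<in> S \<and> b \<in> T \<and> a \<otimes> b = g} \<rightarrow> {a \<in> C. a \<in> S \<and> inv a \<otimes> g \<in> T}"
      using S T g by (auto simp: C_def m_assoc[symmetric])
    show "(\<lambda>a. (a, inv a \<otimes> g)) \<in> {a \<in> C. a \<in> S \<and> inv a \<otimes> g \<in> T}
        \<rightarrow> {(a, b). a \<in> S \<and> b \<in> T \<and> a \<otimes> b = g}"
      using g by (auto simp: C_def m_assoc[symmetric])
    show "(fst x, inv (fst x) \<otimes> g) = x" if "x \<in> {(a, b). a \<in> S \<and> b \<in> T \<and> a \<otimes> b = g}" for x
      using that S T by (auto simp: m_assoc[symmetric])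
  qed auto
  then have "4 * real (prod_count G S T g)
      = 4 * (\<Sum>a\<in>C. if a \<in> S \<and> inv a \<otimes> g \<in> T then 1 else 0)"
    using fin by (simp add: prod_count_def C_def Int_def sum.If_cases)
  also have "\<dots> = (\<Sum>a\<in>C. (1 + ?\<chi> a) * (1 - ?\<chi> (inv a \<otimes> g)))"
  proof -
    have "4 * (if a \<in> S \<and> inv a \<otimes> g \<in> T then 1 else 0) = (1 + ?\<chi> a) * (1 - ?\<chi> (inv a \<otimes> g))"
      if a: "a \<in> C" for a
    proof -
      have "inv a \<otimes> g \<noteq> \<one>" using a g by (auto simp: C_def inv_solve_left')
      then show ?thesis using a g T by (auto simp: C_def sign_of_def)
    qed
    then show ?thesis unfolding sum_distrib_left by (intro sum.cong) auto
  qed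
  also have "\<dots> = real (card C) + (\<Sum>a\<in>C. ?\<chi> a) - (\<Sum>a\<in>C. ?\<chi> (inv a \<otimes> g))
      - (\<Sum>a\<in>C. ?\<chi> a * ?\<chi> (inv a \<otimes> g))"
    by (simp add: algebra_simps sum.distrib sum_subtractf)
  also have "(\<Sum>a\<in>C. ?\<chi> (inv a \<otimes> g)) = (\<Sum>a\<in>C. ?\<chi> a)"
    using split[of ?\<chi>] split[of "\<lambda>a. ?\<chi> (inv a \<otimes> g)"] sum_translate_inverse[OF g(1), of ?\<chi>] \<chi>1 g
    by simp
  also have "(\<Sum>a\<in>C. ?\<chi> a * ?\<chi> (inv a \<otimes> g)) = (\<Sum>a\<in>carrier G. ?\<chi> a * ?\<chi> (inv a \<otimes> g))"
    using split[of "\<lambda>a. ?\<chi> a * ?\<chi> (inv a \<otimes> g)"] \<chi>1 g by simp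
  also have "real (card C) = real (order G) - 2"
    using split[of "\<lambda>_. 1"] by (simp add: order_def)
  finally show ?thesis by simp
qed

lemma convolution_enumerated:
  assumes h: "bij_betw h {..<order G} (carrier G)" and x: "x \<in> carrier G" and y: "y \<in> carrier G"
  shows "(\<Sum>l<order G. F (x \<otimes> inv (h l)) * F (h l \<otimes> inv y))
    = (\<Sum>a\<in>carrier G. F a * (F (inv a \<otimes> (x \<otimes> inv y)) :: real))"
proof -
  have "(\<Sum>l<order G. F (x \<otimes> inv (h l)) * F (h l \<otimes> inv y))
      = (\<Sum>z\<in>carrier G. F (x \<otimes> inv z) * F (z \<otimes> inv y))"
    by (rule sum.reindex_bij_betw[OF h])
  also have "\<dots> = (\<Sum>a\<in>carrier G. F a * F (inv a \<otimes> (x \<otimes> inv y)))"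
    using x y
    by (intro sum.reindex_bij_witness[of _ "\<lambda>a. inv a \<otimes> x" "\<lambda>z. x \<otimes> inv z"])
       (simp_all add: inv_mult_group m_assoc[symmetric] inv_solve_right, simp_all add: m_assoc)
  finally show ?thesis .
qed

text \<open>
  The symmetry of \<open>S\<close> and \<open>T\<close> enters twice: it makes \<open>Q\<close> self-adjoint, and it makes
  \<open>\<chi> a * \<chi> (inv a)\<close> a square, so that the convolution at the identity is the number of elements other
  than \<open>\<one>\<close> and the diagonal of the quadratic equation holds for every \<open>\<mu>\<close>.
\<close>

lemma signature_set_iff_convolution:
  assumes fin: "finite (carrier G)" and n: "order G \<ge> 2"
    and h: "bij_betw h {..<order G} (carrier G)"
    and S: "S \<subseteq> carrier G - {\<one>}" and T: "T = (carrier G - {\<one>}) - S"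
    and S_inv: "S = set_inv S" and T_inv: "T = set_inv T"
  shows "is_signature_set_at G h S \<mu> \<longleftrightarrow>
    (\<forall>g\<in>carrier G - {\<one>}. (\<Sum>a\<in>carrier G. sign_of S T a * sign_of S T (inv a \<otimes> g))
      = \<mu> * sign_of S T g)"
proof -
  let ?n = "order G" and ?\<chi> = "sign_of S T"
  define Q where "Q = signature_sum G h S T"
  define conv where "conv g = (\<Sum>a\<in>carrier G. ?\<chi> a * ?\<chi> (inv a \<otimes> g))" for g
  have ST: "S \<subseteq> carrier G" "T \<subseteq> carrier G" "S \<inter> T = {}" using S T by auto
  have hc: "h i \<in> carrier G" if "i < ?n" for i using h that by (auto simp: bij_betw_def)
  have Q_entry: "Q $$ (i, j) = complex_of_real (?\<chi> (h i \<otimes> inv (h j)))" if "i < ?n" "j < ?n" for i j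
    unfolding Q_def by (rule signature_sum_index(2)[OF fin h ST that])
  have Q_carrier: "Q \<in> carrier_mat ?n ?n"
    unfolding Q_def by (rule signature_sum_index(1)[OF fin h ST, of 0 0]) (use n in auto)
  have in_set_inv: "inv g \<in> set_inv A" if "g \<in> A" for g A
    using that by (auto simp: SET_INV_def)
  have \<chi>_inv: "?\<chi> (inv g) = ?\<chi> g" if "g \<in> carrier G" for g
  proof -
    have "inv g \<in> S \<longleftrightarrow> g \<in> S" "inv g \<in> T \<longleftrightarrow> g \<in> T"
      using in_set_inv[of g S] in_set_inv[of "inv g" S] in_set_inv[of g T] in_set_inv[of "inv g" T]
        S_inv T_inv that by auto
    then show ?thesis by (simp add: sign_of_def)
  qed
  have \<chi>_one: "?\<chi> \<one> = 0" using S T by (auto simp: sign_of_def)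
  have \<chi>_abs: "\<bar>?\<chi> g\<bar> = 1" if "g \<in> carrier G" "g \<noteq> \<one>" for g
    using that T by (auto simp: sign_of_def)
  have quotient_one: "h i \<otimes> inv (h j) = \<one> \<longleftrightarrow> i = j" if "i < ?n" "j < ?n" for i j
    using h hc that by (metis bij_betw_def inj_on_eq_iff inv_equality inv_inv inv_closed r_inv lessThan_iff)
  have diag: "Q $$ (i, i) = 0" if "i < ?n" for i
    using that hc \<chi>_one by (simp add: Q_entry)
  have unimod: "cmod (Q $$ (i, j)) = 1" if "i < ?n" "j < ?n" "i \<noteq> j" for i j
    using that hc quotient_one \<chi>_abs by (simp add: Q_entry)
  have "Q $$ (j, i) = cnj (Q $$ (i, j))" if "i < ?n" "j < ?n" for i j
    using that hc \<chi>_inv[of "h i \<otimes> inv (h j)"] by (simp add: Q_entry inv_mult_group)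
  then have adj: "mat_adjoint Q = Q"
    unfolding mat_adjoint_eq_self_iff[OF Q_carrier] by blast
  have conv_one: "conv \<one> = real ?n - 1"
  proof -
    have "conv \<one> = (\<Sum>a\<in>carrier G. \<bar>?\<chi> a\<bar>\<^sup>2)"
      unfolding conv_def by (intro sum.cong) (simp_all add: \<chi>_inv power2_eq_square)
    also have "\<dots> = (\<Sum>a\<in>carrier G - {\<one>}. \<bar>?\<chi> a\<bar>\<^sup>2)"
      using fin \<chi>_one by (simp add: sum.remove[of _ \<one>])
    also have "\<dots> = (\<Sum>a\<in>carrier G - {\<one>}. 1)"
      by (intro sum.cong) (simp_all add: \<chi>_abs del: power2_abs)
    also have "\<dots> = real ?n - 1" using fin n by (simp add: order_def)
    finally show ?thesis .
  qed
  have quad_entry: "(\<Sum>l<?n. Q $$ (i, l) * Q $$ (l, j))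
        = complex_of_real (real ?n - 1) * (if i = j then 1 else 0) + complex_of_real \<mu> * Q $$ (i, j)
      \<longleftrightarrow> i = j \<or> conv (h i \<otimes> inv (h j)) = \<mu> * ?\<chi> (h i \<otimes> inv (h j))"
    if ij: "i < ?n" "j < ?n" for i j
  proof -
    have "(\<Sum>l<?n. Q $$ (i, l) * Q $$ (l, j))
        = complex_of_real (\<Sum>l<?n. ?\<chi> (h i \<otimes> inv (h l)) * ?\<chi> (h l \<otimes> inv (h j)))"
      using ij by (simp add: Q_entry)
    also have "\<dots> = complex_of_real (conv (h i \<otimes> inv (h j)))"
      unfolding conv_def convolution_enumerated[OF h hc[OF ij(1)] hc[OF ij(2)]] ..
    finally have lhs: "(\<Sum>l<?n. Q $$ (i, l) * Q $$ (l, j)) = complex_of_real (conv (h i \<otimes> inv (h j)))" .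
    show ?thesis
    proof (cases "i = j")
      case True
      then show ?thesis using lhs conv_one quotient_one[OF ij] diag[OF ij(1)] by simp
    next
      case False
      have "complex_of_real (conv (h i \<otimes> inv (h j))) = complex_of_real (\<mu> * ?\<chi> (h i \<otimes> inv (h j)))
          \<longleftrightarrow> conv (h i \<otimes> inv (h j)) = \<mu> * ?\<chi> (h i \<otimes> inv (h j))" by (rule of_real_eq_iff)
      then show ?thesis using False lhs by (simp add: Q_entry[OF ij])
    qed
  qed
  have "is_signature_set_at G h S \<mu> \<longleftrightarrow> (\<exists>k. real k = frame_dim ?n \<mu> \<and> is_signature_matrix ?n k Q)"
    using S by (simp add: is_signature_set_at_def is_signature_set_def Q_def T)
  also have "\<dots> \<longleftrightarrow> (\<forall>i<?n. \<forall>j<?n. i = j \<or> conv (h i \<otimes> inv (h j)) = \<mu> * ?\<chi> (h i \<otimes> inv (h j)))"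
    by (rule trans[OF signature_matrix_iff_quadratic[OF n Q_carrier adj diag unimod]])
      (assumption | intro all_cong quad_entry)+
  also have "\<dots> \<longleftrightarrow> (\<forall>g\<in>carrier G - {\<one>}. conv g = \<mu> * ?\<chi> g)"
  proof
    assume H: "\<forall>i<?n. \<forall>j<?n. i = j \<or> conv (h i \<otimes> inv (h j)) = \<mu> * ?\<chi> (h i \<otimes> inv (h j))"
    show "\<forall>g\<in>carrier G - {\<one>}. conv g = \<mu> * ?\<chi> g"
    proof
      fix g assume g: "g \<in> carrier G - {\<one>}"
      have surj: "\<exists>i<?n. h i = x" if "x \<in> carrier G" for x
        using h that unfolding bij_betw_def by (metis imageE lessThan_iff)
      \<comment> \<open>The column of the identity contains every value of \<open>\<chi>\<close>.\<close>
      obtain i j where ij: "i < ?n" "h i = g" "j < ?n" "h j = \<one>"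
        using surj[of g] surj[of \<one>] g by auto
      then have "i \<noteq> j" using g by auto
      then show "conv g = \<mu> * ?\<chi> g" using H ij g by force
    qed
  next
    assume "\<forall>g\<in>carrier G - {\<one>}. conv g = \<mu> * ?\<chi> g"
    then show "\<forall>i<?n. \<forall>j<?n. i = j \<or> conv (h i \<otimes> inv (h j)) = \<mu> * ?\<chi> (h i \<otimes> inv (h j))"
      using quotient_one hc by auto
  qed
  finally show ?thesis unfolding conv_def .
qed

end

theorem theorem3p8:
  fixes G :: "('a, 'b) monoid_scheme" (structure)
    and n :: nat and h :: "nat \<Rightarrow> 'a" and S T :: "'a set"
  assumes "group G"
    and "finite (carrier G)"
    and "order G = n"
    and "n \<ge> 2"
    and "bij_betw h {..<n} (carrier G)"
    and "S \<subseteq> carrier G - {\<one>}"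
    and "T = (carrier G - {\<one>}) - S"
    and "S = set_inv S"
    and "T = set_inv T"
  shows "((\<exists>\<mu>::real. is_signature_set_at G h S \<mu>) \<longleftrightarrow>
          (\<exists>\<mu>::real. (\<forall>g\<in>S. real (prod_count G S T g) = (real n - 2 - \<mu>) / 4) \<and>
                     (\<forall>g\<in>T. real (prod_count G S T g) = (real n - 2 + \<mu>) / 4)))
       \<and> (\<forall>\<mu>::real. is_signature_set_at G h S \<mu> \<longleftrightarrow>
            (\<forall>g\<in>S. real (prod_count G S T g) = (real n - 2 - \<mu>) / 4) \<and>
            (\<forall>g\<in>T. real (prod_count G S T g) = (real n - 2 + \<mu>) / 4))"
proof -
  interpret group G by fact
  let ?\<chi> = "sign_of S T"
  define conv where "conv g = (\<Sum>a\<in>carrier G. ?\<chi> a * ?\<chi> (inv a \<otimes> g))" for g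
  have count: "4 * real (prod_count G S T g) = real n - 2 - conv g" if "g \<in> carrier G - {\<one>}" for g
    using prod_count_eq_convolution[OF assms(2,6,7), of g] that assms(3) by (simp add: conv_def)
  have "is_signature_set_at G h S \<mu> \<longleftrightarrow>
      (\<forall>g\<in>S. real (prod_count G S T g) = (real n - 2 - \<mu>) / 4) \<and>
      (\<forall>g\<in>T. real (prod_count G S T g) = (real n - 2 + \<mu>) / 4)" for \<mu>
  proof -
    have "is_signature_set_at G h S \<mu> \<longleftrightarrow> (\<forall>g\<in>carrier G - {\<one>}. conv g = \<mu> * ?\<chi> g)"
      unfolding conv_def using assms by (intro signature_set_iff_convolution) simp_all
    also have "\<dots> \<longleftrightarrow> (\<forall>g\<in>S. conv g = \<mu>) \<and> (\<forall>g\<in>T. conv g = - \<mu>)"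
      using assms(6,7) by (auto simp: sign_of_def)
    also have "(\<forall>g\<in>S. conv g = \<mu>) \<longleftrightarrow> (\<forall>g\<in>S. real (prod_count G S T g) = (real n - 2 - \<mu>) / 4)"
    proof (rule ball_cong[OF refl])
      fix g assume "g \<in> S"
      then have "4 * real (prod_count G S T g) = real n - 2 - conv g"
        using assms(6) by (intro count) auto
      then show "conv g = \<mu> \<longleftrightarrow> real (prod_count G S T g) = (real n - 2 - \<mu>) / 4" by auto
    qed
    also have "(\<forall>g\<in>T. conv g = - \<mu>) \<longleftrightarrow> (\<forall>g\<in>T. real (prod_count G S T g) = (real n - 2 + \<mu>) / 4)"
    proof (rule ball_cong[OF refl])
      fix g assume "g \<in> T"
      then have "4 * real (prod_count G S T g) = real n - 2 - conv g"
        using assms(7) by (intro count) auto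
      then show "conv g = - \<mu> \<longleftrightarrow> real (prod_count G S T g) = (real n - 2 + \<mu>) / 4" by auto
    qed
    finally show ?thesis .
  qed
  then show ?thesis by blast
qed

end
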